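(* Let $n\ge0$ be an integer, $\varrho>-1$, $\Upsilon$ a positive integer, $\mu\in\mathbb{C}$ with $\mathrm{Re}(\mu)>0$, $w\in\mathbb{C}$, $B\in\mathbb{R}$. For $Y>B$, $${}_{Y}I^{\mu}_{B^+}\left[(Y-B)^{\varrho}\,{}_{\Upsilon}H_n^{\varrho}(X,w(Y-B))\right]=(Y-B)^{\varrho+\mu}\,{}_{\Upsilon}H_n^{\varrho+\mu}(X,w(Y-B)).$$
   Context: $(a)_k$ is the Pochhammer symbol and $[\cdot]$ the integer part. The 2D Hermite–Konhauser polynomials are $${}_{\Upsilon}H_n^{\varrho}(X,Y)=\sum_{s=0}^{[n/2]}\sum_{r=0}^{n-s}\frac{(-1)^s(-n)_{2s}(-n)_{s+r}}{(-n)_s\,\Gamma(\varrho+1+\Upsilon r)\,s!\,r!}(2X)^{n-2s}Y^{\Upsilon r}$$ (the same formula is used for complex $\varrho$). The Riemann–Liouville fractional integral is ${}_{Y}I^{\mu}_{B^+}(f)(Y)=\frac{1}{\Gamma(\mu)}\int_B^Y(Y-t)^{\mu-1}f(t)\,dt$. *)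

theory Defs
  imports "HOL-Analysis.Analysis"
begin

definition hermite_konhauser ::
    "nat \<Rightarrow> nat \<Rightarrow> complex \<Rightarrow> complex \<Rightarrow> complex \<Rightarrow> complex" where
  "hermite_konhauser \<Upsilon> n \<rho> X Y =
     (\<Sum>s=0..n div 2. \<Sum>r=0..n - s.
        (-1) ^ s * pochhammer (- of_nat n) (2 * s) * pochhammer (- of_nat n) (s + r)
        / (pochhammer (- of_nat n) s * Gamma (\<rho> + 1 + of_nat (\<Upsilon> * r)) * fact s * fact r)
        * (2 * X) ^ (n - 2 * s) * Y ^ (\<Upsilon> * r))"

text \<open>
  Complex powers of positive reals are principal values, so \<open>of_real (Y - t) powr (\<mu> - 1)\<close>
  is \<open>exp ((\<mu> - 1) * ln (Y - t))\<close> for \<open>t < Y\<close>. The interval integral is the Lebesgue integral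
  over the open interval from \<open>B\<close> to \<open>Y\<close>; since it is \<open>0\<close> when the integrand is not integrable,
  the existence of the fractional integral is a separate predicate.
\<close>

definition RL_integrable :: "complex \<Rightarrow> real \<Rightarrow> (real \<Rightarrow> complex) \<Rightarrow> real \<Rightarrow> bool" where
  "RL_integrable \<mu> B f Y \<longleftrightarrow>
     interval_lebesgue_integrable lborel (ereal B) (ereal Y)
       (\<lambda>t. of_real (Y - t) powr (\<mu> - 1) * f t)"

definition RL_integral :: "complex \<Rightarrow> real \<Rightarrow> (real \<Rightarrow> complex) \<Rightarrow> real \<Rightarrow> complex" where
  "RL_integral \<mu> B f Y =
     1 / Gamma \<mu> * (LBINT t=ereal B..ereal Y. of_real (Y - t) powr (\<mu> - 1) * f t)"

end

(* The operator acts on each power (t - B)^(\<rho> + \<Upsilon> r) by a complex Beta integral, which turns the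
   factor 1 / Gamma(\<rho> + 1 + \<Upsilon> r) of the polynomial into 1 / Gamma(\<rho> + \<mu> + 1 + \<Upsilon> r). The Beta
   integral for complex parameters comes from convolving the densities t^(a-1) exp(-t) and
   t^(b-1) exp(-t): by scaling the convolution is x^(a+b-1) exp(-x) times the Beta integral, and its
   total mass is Gamma(a) Gamma(b). *)
theory Submission imports Defs begin

text \<open>By Fubini the order of integration can be swapped; by translation invariance the
  integral over x then no longer depends on t and factors out.\<close>

lemma integral_convolution:
  fixes f g :: "real \<Rightarrow> complex"
  assumes f: "integrable lborel f" and g: "integrable lborel g"
  shows "(LBINT x. LBINT t. f t * g (x - t)) = (LBINT t. f t) * (LBINT x. g x)"
proof -
  have [measurable]: "f \<in> borel_measurable borel" "g \<in> borel_measurable borel"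
    using f g by (auto dest!: borel_measurable_integrable)
  have shift: "integrable lborel (\<lambda>x. g (x - t))" "(LBINT x. g (x - t)) = (LBINT x. g x)" for t
    using lborel_integrable_real_affine[OF g, of 1 "- t"]
      lborel_integral_real_affine[of 1 g "- t"] by (simp_all add: algebra_simps)
  have norm_shift: "(LBINT x. norm (g (x - t))) = (LBINT x. norm (g x))" for t
    using lborel_integral_real_affine[of 1 "\<lambda>x. norm (g x)" "- t"] by (simp add: algebra_simps)
  have int: "integrable (lborel \<Otimes>\<^sub>M lborel) (\<lambda>(t, x). f t * g (x - t))"
  proof (rule lborel_pair.Fubini_integrable)
    show "integrable lborel (\<lambda>t. LBINT x. norm (case (t, x) of (t, x) \<Rightarrow> f t * g (x - t)))"
      using f by (simp add: norm_mult norm_shift)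
    show "AE t in lborel. integrable lborel (\<lambda>x. case (t, x) of (t, x) \<Rightarrow> f t * g (x - t))"
      using shift by simp
  qed measurable
  have "(LBINT x. LBINT t. f t * g (x - t)) = (LBINT t. LBINT x. f t * g (x - t))"
    using lborel_pair.Fubini_integral[OF int] by simp
  then show ?thesis
    by (simp add: shift)
qed

text \<open>The principal logarithm jumps across the negative real axis, so continuity is not
  enough. Restricted to the reals it is piecewise elementary: negative bases have argument pi, and
  base 0 has the default power 0.\<close>

lemma borel_measurable_of_real_powr [measurable]:
  fixes z :: complex
  assumes [measurable]: "f \<in> borel_measurable M"
  shows "(\<lambda>x. complex_of_real (f x) powr z) \<in> borel_measurable M"
proof -
  have "complex_of_real u powr z = (if u = 0 then 0 else
      exp (z * (of_real (ln \<bar>u\<bar>) + (if u < 0 then of_real pi * \<i> else 0))))" for u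
    by (auto simp: powr_def Ln_of_real')
  then show ?thesis
    by simp
qed

text \<open>\<open>Gamma\<close> is 0 only by convention, at its poles, and these are the
  nonpositive integers.\<close>

lemma Gamma_nonzero_Re_pos:
  fixes z :: complex
  assumes "Re z > 0"
  shows "Gamma z \<noteq> 0"
  using assms by (auto simp: Gamma_eq_zero_iff elim!: nonpos_Ints_cases)

text \<open>Transfers Euler's integral from the completed Lebesgue measure to \<open>lborel\<close>,
  which is possible because the integrand is Borel measurable.\<close>

lemma has_bochner_integral_Gamma_complex:
  assumes "Re z > 0"
  shows "has_bochner_integral lborel
    (\<lambda>t. indicator {0<..} t *\<^sub>R (complex_of_real t powr (z - 1) / of_real (exp t))) (Gamma z)"
proof -
  let ?k = "\<lambda>t. complex_of_real t powr (z - 1) / of_real (exp t)"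
  have "set_integrable lborel {0<..} ?k"
    using absolutely_integrable_Gamma_integral'[OF assms] unfolding set_integrable_def
    by (subst (asm) integrable_completion) simp_all
  then show ?thesis
    using set_borel_integral_eq_integral[of "{0<..}" ?k] Gamma_integral_complex'[OF assms]
    by (simp add: has_bochner_integral_iff set_integrable_def set_lebesgue_integral_def integral_unique)
qed

text \<open>This is the integrand of the convolution at x of the powers u^(a-1) and u^(b-1), each
  cut off to u > 0. At x = 1 it is the integrand of Euler's Beta integral.\<close>

abbreviation beta_kernel :: "complex \<Rightarrow> complex \<Rightarrow> real \<Rightarrow> real \<Rightarrow> complex" where
  "beta_kernel a b x t \<equiv>
     indicator {0<..<x} t *\<^sub>R (complex_of_real t powr (a - 1) * of_real (x - t) powr (b - 1))"

text \<open>The modulus is the real Beta integrand with parameters Re a and Re b.\<close>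

lemma integrable_beta_kernel_1:
  assumes "Re a > 0" "Re b > 0"
  shows "integrable lborel (beta_kernel a b 1)"
proof (rule Bochner_Integration.integrable_bound)
  show "integrable lborel (\<lambda>t. indicator {0..1} t *\<^sub>R (t powr (Re a - 1) * (1 - t) powr (Re b - 1)))"
    using integrable_Beta[of "Re a" "Re b"] assms by (simp add: set_integrable_def)
  show "AE t in lborel. norm (beta_kernel a b 1 t) \<le>
          norm (indicator {0..1} t *\<^sub>R (t powr (Re a - 1) * (1 - t) powr (Re b - 1)))"
    by (simp add: indicator_def norm_mult norm_powr_real_powr)
qed measurable

text \<open>The two factors are homogeneous of degrees a - 1 and b - 1, since complex powers of
  positive reals are multiplicative in the base.\<close>

lemma beta_kernel_scale:
  assumes "x > 0"
  shows "beta_kernel a b x (x * t) = of_real x powr (a + b - 2) * beta_kernel a b 1 t"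
proof (cases "t \<in> {0<..<1}")
  case True
  then have "complex_of_real (x * t) powr (a - 1) = of_real x powr (a - 1) * of_real t powr (a - 1)"
    "complex_of_real (x - x * t) powr (b - 1) = of_real x powr (b - 1) * of_real (1 - t) powr (b - 1)"
    using assms powr_times_real[of "of_real x" "of_real t" "a - 1"]
      powr_times_real[of "of_real x" "of_real (1 - t)" "b - 1"]
    by (simp_all add: right_diff_distrib)
  moreover have "complex_of_real x powr (a + b - 2) = of_real x powr (a - 1) * of_real x powr (b - 1)"
    by (simp flip: powr_add)
  ultimately show ?thesis
    using True assms by (simp add: indicator_def)
qed (use assms in \<open>auto simp: indicator_def zero_less_mult_iff\<close>)

lemma has_bochner_integral_beta_kernel_scale:
  assumes "Re a > 0" "Re b > 0" "x > 0"
  shows "has_bochner_integral lborel (beta_kernel a b x)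
    (of_real x powr (a + b - 1) * (LBINT t. beta_kernel a b 1 t))"
proof -
  have "has_bochner_integral lborel (\<lambda>t. beta_kernel a b x (x * t))
    (of_real x powr (a + b - 2) * (LBINT t. beta_kernel a b 1 t))"
    unfolding beta_kernel_scale[OF assms(3)]
    using integrable_beta_kernel_1[OF assms(1,2)]
    by (intro has_bochner_integral_mult_right has_bochner_integral_integrable)
  \<comment> \<open>The substitution t to x * t divides the integral by x, which accounts for the
    step from exponent a + b - 1 to a + b - 2.\<close>
  moreover have "(of_real x powr (a + b - 1) * c) /\<^sub>R x = complex_of_real x powr (a + b - 2) * c" for c
    using powr_add[of "of_real x" "a + b - 2" "1::complex"] assms
    by (simp add: scaleR_conv_of_real field_simps)
  ultimately show ?thesis
    using assms by (subst lborel_has_bochner_integral_real_affine_iff[of x _ _ 0]) simp_all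
qed

lemma Beta_integral_complex:
  assumes a: "Re a > 0" and b: "Re b > 0"
  shows "(LBINT t. beta_kernel a b 1 t) = Beta a b"
proof -
  define k where "k = (\<lambda>z t. indicator {0<..} t *\<^sub>R (complex_of_real t powr (z - 1) / of_real (exp t)))"
  have k: "integrable lborel (k z)" "(LBINT t. k z t) = Gamma z" if "Re z > 0" for z
    using has_bochner_integral_Gamma_complex[OF that] by (simp_all add: k_def has_bochner_integral_iff)
  have conv: "(LBINT t. k a t * k b (x - t)) = k (a + b) x * (LBINT t. beta_kernel a b 1 t)" for x
  proof -
    \<comment> \<open>exp(-t) exp(-(x - t)) = exp(-x) is free of t, and the two cutoffs together say
      0 < t < x.\<close>
    have "k a t * k b (x - t) = beta_kernel a b x t / of_real (exp x)" for t
      by (auto simp: k_def indicator_def exp_diff)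
    then have "(LBINT t. k a t * k b (x - t)) = (LBINT t. beta_kernel a b x t) / of_real (exp x)"
      by simp
    also have "\<dots> = k (a + b) x * (LBINT t. beta_kernel a b 1 t)"
    \<comment> \<open>For x \<le> 0 both sides vanish, by the empty interval and by the cutoff in
      \<open>k\<close>.\<close>
    proof (cases "x > 0")
      case True
      then show ?thesis
        using has_bochner_integral_beta_kernel_scale[OF a b True]
        by (simp add: k_def has_bochner_integral_iff)
    qed (simp add: k_def)
    finally show ?thesis .
  qed
  have "Gamma a * Gamma b = (LBINT x. LBINT t. k a t * k b (x - t))"
    using integral_convolution[OF k(1)[OF a] k(1)[OF b]] by (simp add: k a b)
  also have "\<dots> = Gamma (a + b) * (LBINT t. beta_kernel a b 1 t)"
    using a b by (simp add: conv k)
  finally have "Gamma (a + b) * (LBINT t. beta_kernel a b 1 t) = Gamma a * Gamma b" ..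
  moreover have "Gamma (a + b) \<noteq> 0"
    using a b by (intro Gamma_nonzero_Re_pos) simp
  ultimately show ?thesis
    by (simp add: Beta_def field_simps)
qed

lemma has_bochner_integral_beta_kernel:
  assumes "Re a > 0" "Re b > 0" "x > 0"
  shows "has_bochner_integral lborel (beta_kernel a b x) (of_real x powr (a + b - 1) * Beta a b)"
  using has_bochner_integral_beta_kernel_scale[OF assms] Beta_integral_complex assms by simp

lemma has_bochner_integral_RL_power:
  assumes "\<rho> > -1" "Re \<mu> > 0" "B < Y"
  shows "has_bochner_integral lborel
    (\<lambda>t. indicator {B<..<Y} t *\<^sub>R (complex_of_real (Y - t) powr (\<mu> - 1) *
           (of_real (t - B) powr of_real \<rho> * of_real (t - B) ^ m)))
    (of_real (Y - B) powr (of_real \<rho> + \<mu>) * of_real (Y - B) ^ m *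
       (Gamma (of_real \<rho> + 1 + of_nat m) * Gamma \<mu> / Gamma (of_real \<rho> + \<mu> + 1 + of_nat m)))"
proof -
  have powr_nat: "complex_of_real u powr (z + of_nat m) = of_real u powr z * of_real u ^ m"
    if "u > 0" for u z
    using that by (simp add: powr_add powr_nat)
  \<comment> \<open>The argument \<open>- B + 1 * t\<close> has the shape of the affine substitution
    rule with slope 1 and shift -B.\<close>
  have *: "beta_kernel (of_real \<rho> + 1 + of_nat m) \<mu> (Y - B) (- B + 1 * t) =
      indicator {B<..<Y} t *\<^sub>R (complex_of_real (Y - t) powr (\<mu> - 1) *
           (of_real (t - B) powr of_real \<rho> * of_real (t - B) ^ m))" for t
    using powr_nat[of "t - B" "of_real \<rho>"] by (auto simp: indicator_def add.commute)
  have "of_real (Y - B) powr (of_real \<rho> + 1 + of_nat m + \<mu> - 1) =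
      complex_of_real (Y - B) powr (of_real \<rho> + \<mu>) * of_real (Y - B) ^ m"
    using powr_nat[of "Y - B" "of_real \<rho> + \<mu>"] assms by (simp add: algebra_simps)
  then show ?thesis
    using has_bochner_integral_beta_kernel[of "of_real \<rho> + 1 + of_nat m" \<mu> "Y - B"] assms
      lborel_has_bochner_integral_real_affine_iff[of 1 "beta_kernel (of_real \<rho> + 1 + of_nat m) \<mu> (Y - B)" _ "- B"]
    unfolding * by (simp add: Beta_def algebra_simps)
qed

theorem corollary5:
  fixes n \<Upsilon> :: nat and \<rho> B Y :: real and \<mu> w X :: complex
  assumes "\<rho> > -1" and "\<Upsilon> > 0" and "Re \<mu> > 0" and "Y > B"
  defines "f \<equiv> (\<lambda>t::real. complex_of_real (t - B) powr complex_of_real \<rho> *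
      hermite_konhauser \<Upsilon> n (complex_of_real \<rho>) X (w * complex_of_real (t - B)))"
  shows "RL_integrable \<mu> B f Y \<and>
    RL_integral \<mu> B f Y =
      complex_of_real (Y - B) powr (complex_of_real \<rho> + \<mu>) *
      hermite_konhauser \<Upsilon> n (complex_of_real \<rho> + \<mu>) X (w * complex_of_real (Y - B))"
proof -
  define p where "p = (\<lambda>m t. indicator {B<..<Y} t *\<^sub>R (complex_of_real (Y - t) powr (\<mu> - 1) *
           (of_real (t - B) powr of_real \<rho> * of_real (t - B) ^ m)))"
  \<comment> \<open>These coefficients do not contain \<rho>, so the polynomials for \<rho> and
    \<rho> + \<mu> differ only in the Gamma factor that \<open>hk\<close> splits off.\<close>
  define c where "c = (\<lambda>s r. (-1) ^ s * pochhammer (- of_nat n) (2 * s) * pochhammer (- of_nat n) (s + r)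
        / (pochhammer (- of_nat n) s * fact s * fact r) * (2 * X) ^ (n - 2 * s) * w ^ (\<Upsilon> * r))"
  have hk: "hermite_konhauser \<Upsilon> n z X (w * u) =
      (\<Sum>s=0..n div 2. \<Sum>r=0..n - s. c s r / Gamma (z + 1 + of_nat (\<Upsilon> * r)) * u ^ (\<Upsilon> * r))" for z u
    unfolding hermite_konhauser_def c_def
    by (intro sum.cong refl) (simp add: power_mult_distrib field_simps)
  have p_int: "has_bochner_integral lborel (p m) (of_real (Y - B) powr (of_real \<rho> + \<mu>) * of_real (Y - B) ^ m *
       (Gamma (of_real \<rho> + 1 + of_nat m) * Gamma \<mu> / Gamma (of_real \<rho> + \<mu> + 1 + of_nat m)))" for m
    unfolding p_def using assms by (intro has_bochner_integral_RL_power) auto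
  have integrand: "indicator {B<..<Y} t *\<^sub>R (of_real (Y - t) powr (\<mu> - 1) * f t) =
      (\<Sum>s=0..n div 2. \<Sum>r=0..n - s. c s r / Gamma (of_real \<rho> + 1 + of_nat (\<Upsilon> * r)) * p (\<Upsilon> * r) t)" for t
    unfolding f_def hk p_def by (simp add: sum_distrib_left scaleR_sum_right mult_ac)
  have "has_bochner_integral lborel (\<lambda>t. indicator {B<..<Y} t *\<^sub>R (of_real (Y - t) powr (\<mu> - 1) * f t))
      (\<Sum>s=0..n div 2. \<Sum>r=0..n - s. c s r / Gamma (of_real \<rho> + 1 + of_nat (\<Upsilon> * r)) *
         (of_real (Y - B) powr (of_real \<rho> + \<mu>) * of_real (Y - B) ^ (\<Upsilon> * r) *
         (Gamma (of_real \<rho> + 1 + of_nat (\<Upsilon> * r)) * Gamma \<mu> / Gamma (of_real \<rho> + \<mu> + 1 + of_nat (\<Upsilon> * r)))))"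
    unfolding integrand
    by (intro has_bochner_integral_sum has_bochner_integral_mult_right p_int)
  also have "(\<Sum>s=0..n div 2. \<Sum>r=0..n - s. c s r / Gamma (of_real \<rho> + 1 + of_nat (\<Upsilon> * r)) *
         (of_real (Y - B) powr (of_real \<rho> + \<mu>) * of_real (Y - B) ^ (\<Upsilon> * r) *
         (Gamma (of_real \<rho> + 1 + of_nat (\<Upsilon> * r)) * Gamma \<mu> / Gamma (of_real \<rho> + \<mu> + 1 + of_nat (\<Upsilon> * r)))))
     = Gamma \<mu> * (of_real (Y - B) powr (of_real \<rho> + \<mu>) *
         hermite_konhauser \<Upsilon> n (of_real \<rho> + \<mu>) X (w * of_real (Y - B)))"
    unfolding hk sum_distrib_left
  proof (intro sum.cong refl)
    fix s r
    \<comment> \<open>The Beta integral puts this Gamma value in the numerator, where it has to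
      cancel the one in the denominator of the coefficient.\<close>
    have "Gamma (of_real \<rho> + 1 + of_nat (\<Upsilon> * r) :: complex) \<noteq> 0"
      using assms(1) by (intro Gamma_nonzero_Re_pos) (simp add: add_pos_nonneg)
    then show "c s r / Gamma (of_real \<rho> + 1 + of_nat (\<Upsilon> * r)) *
         (of_real (Y - B) powr (of_real \<rho> + \<mu>) * of_real (Y - B) ^ (\<Upsilon> * r) *
         (Gamma (of_real \<rho> + 1 + of_nat (\<Upsilon> * r)) * Gamma \<mu> / Gamma (of_real \<rho> + \<mu> + 1 + of_nat (\<Upsilon> * r)))) =
       Gamma \<mu> * (of_real (Y - B) powr (of_real \<rho> + \<mu>) *
         (c s r / Gamma (of_real \<rho> + \<mu> + 1 + of_nat (\<Upsilon> * r)) * of_real (Y - B) ^ (\<Upsilon> * r)))"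
      by simp
  qed
  \<comment> \<open>Existence and value are both read off: as B < Y, the interval integral is the
    set integral over \<open>{B<..<Y}\<close>, and the factor Gamma(\<mu>) cancels the
    normalisation.\<close>
  finally show ?thesis
    using assms(4) Gamma_nonzero_Re_pos[OF assms(3)]
    unfolding RL_integrable_def RL_integral_def interval_lebesgue_integrable_def interval_lebesgue_integral_def
    by (simp add: set_integrable_def set_lebesgue_integral_def has_bochner_integral_iff)
qed

end
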